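(* Let $E=(e_X,e_Y,R)$ be an extension polarity extending the poset $P$ (so $e_X:P\to X$, $e_Y:P\to Y$). The following are equivalent: (1) $E$ is 1-coherent; (2) $\preceq_1$ is a 1-preorder for $E$; (3) there exists a 1-preorder for $E$. Moreover, the set of 1-preorders for $E$ is closed under non-empty intersections and, if it is non-empty, has $\preceq_1$ as its smallest member.
   Context: An extension polarity is a triple $(e_X,e_Y,R)$ where $P$ is a poset, $X,Y$ are disjoint posets, $e_X:P\to X$ and $e_Y:P\to Y$ are order embeddings, and $R\subseteq X\times Y$. Coherence conditions: (C1) for all $x_1,x_2\in X$, $y\in Y$: if $x_1\le_X x_2$ and $x_2\mathrel{R}y$ then $x_1\mathrel{R}y$. (C2) for all $y_1,y_2\in Y$, $x\in X$: if $y_1\le_Y y_2$ and $x\mathrel{R}y_1$ then $x\mathrel{R}y_2$. (C3) for all $p\in P$: $e_X(p)\mathrel{R}e_Y(p)$. (C4) for all $p\in P$, $x\in X$, $y\in Y$: if $x\mathrel{R}e_Y(p)$ and $e_X(p)\mathrel{R}y$ then $x\mathrel{R}y$. $E$ is 1-coherent if it satisfies (C1)–(C4). For a preorder $\preceq$ on $X\cup Y$, let $X\uplus_\preceq Y$ be the poset obtained by identifying $z_1,z_2$ whenever $z_1\preceq z_2\preceq z_1$, and let $\iota_X:X\to X\uplus_\preceq Y$, $\iota_Y:Y\to X\uplus_\preceq Y$ be the inclusions followed by the quotient map. A 0-preorder for $E$ is a preorder $\preceq$ on $X\cup Y$ with: $x\preceq y\iff x\mathrel{R}y$ for $x\in X,y\in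 Y$; $x_1\le_X x_2\Rightarrow x_1\preceq x_2$; $y_1\le_Y y_2\Rightarrow y_1\preceq y_2$. A 1-preorder for $E$ is a 0-preorder with $\iota_X\circ e_X=\iota_Y\circ e_Y$. The relation $\preceq_1\subseteq (X\cup Y)^2$ is the union of $R$ with $Z_X=\{(x_1,x_2)\in X^2:\exists p\in P\,(x_1\mathrel{R}e_Y(p)\text{ and }e_X(p)\le_X x_2)\}\cup{\le_X}$, $Z_Y=\{(y_1,y_2)\in Y^2:\exists p\in P\,(y_1\le_Y e_Y(p)\text{ and }e_X(p)\mathrel{R}y_2)\}\cup{\le_Y}$, $Z_{YX}=\{(y,x)\in Y\times X:\exists p,q\in P\,(y\le_Y e_Y(p),\ e_X(p)\mathrel{R}e_Y(q),\ e_X(q)\le_X x)\}$. *)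

theory Defs
  imports Main
begin

text \<open>The posets \<open>X\<close> and \<open>Y\<close> are carrier sets in one common type, so that disjointness and the
  union \<open>X \<union> Y\<close> are the literal set operations. Orders and the polarity relation are sets of
  pairs, supported on the carriers.\<close>

record ('p, 'a) polarity =
  setP :: "'p set"
  leP  :: "'p rel"
  setX :: "'a set"
  leX  :: "'a rel"
  setY :: "'a set"
  leY  :: "'a rel"
  eX   :: "'p \<Rightarrow> 'a"
  eY   :: "'p \<Rightarrow> 'a"
  relR :: "'a rel"

definition order_embedding_on ::
  "'p set \<Rightarrow> 'p rel \<Rightarrow> 'a set \<Rightarrow> 'a rel \<Rightarrow> ('p \<Rightarrow> 'a) \<Rightarrow> bool" where
  "order_embedding_on P r A s e \<longleftrightarrow>
     e ` P \<subseteq> A \<and> (\<forall>p\<in>P. \<forall>q\<in>P. (p, q) \<in> r \<longleftrightarrow> (e p, e q) \<in> s)"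

definition extension_polarity :: "('p, 'a) polarity \<Rightarrow> bool" where
  "extension_polarity E \<longleftrightarrow>
     partial_order_on (setP E) (leP E) \<and>
     partial_order_on (setX E) (leX E) \<and>
     partial_order_on (setY E) (leY E) \<and>
     setX E \<inter> setY E = {} \<and>
     order_embedding_on (setP E) (leP E) (setX E) (leX E) (eX E) \<and>
     order_embedding_on (setP E) (leP E) (setY E) (leY E) (eY E) \<and>
     relR E \<subseteq> setX E \<times> setY E"

definition C1 :: "('p, 'a) polarity \<Rightarrow> bool" where
  "C1 E \<longleftrightarrow> (\<forall>x1\<in>setX E. \<forall>x2\<in>setX E. \<forall>y\<in>setY E.
     (x1, x2) \<in> leX E \<and> (x2, y) \<in> relR E \<longrightarrow> (x1, y) \<in> relR E)"

definition C2 :: "('p, 'a) polarity \<Rightarrow> bool" where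
  "C2 E \<longleftrightarrow> (\<forall>y1\<in>setY E. \<forall>y2\<in>setY E. \<forall>x\<in>setX E.
     (y1, y2) \<in> leY E \<and> (x, y1) \<in> relR E \<longrightarrow> (x, y2) \<in> relR E)"

definition C3 :: "('p, 'a) polarity \<Rightarrow> bool" where
  "C3 E \<longleftrightarrow> (\<forall>p\<in>setP E. (eX E p, eY E p) \<in> relR E)"

definition C4 :: "('p, 'a) polarity \<Rightarrow> bool" where
  "C4 E \<longleftrightarrow> (\<forall>p\<in>setP E. \<forall>x\<in>setX E. \<forall>y\<in>setY E.
     (x, eY E p) \<in> relR E \<and> (eX E p, y) \<in> relR E \<longrightarrow> (x, y) \<in> relR E)"

definition one_coherent :: "('p, 'a) polarity \<Rightarrow> bool" where
  "one_coherent E \<longleftrightarrow> C1 E \<and> C2 E \<and> C3 E \<and> C4 E"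

text \<open>The poset \<open>X \<uplus> Y\<close> for a preorder \<open>r\<close> on \<open>X \<union> Y\<close> has the classes of \<open>r \<inter> r\<inverse>\<close> as its
  elements.\<close>

definition uplus_set :: "('p, 'a) polarity \<Rightarrow> 'a rel \<Rightarrow> 'a set set" where
  "uplus_set E r = (setX E \<union> setY E) // (r \<inter> r\<inverse>)"

definition uplus_le :: "('p, 'a) polarity \<Rightarrow> 'a rel \<Rightarrow> 'a set rel" where
  "uplus_le E r = {(A, B). A \<in> uplus_set E r \<and> B \<in> uplus_set E r \<and> (\<exists>a\<in>A. \<exists>b\<in>B. (a, b) \<in> r)}"

text \<open>\<open>Equiv_Relations.proj\<close> is the quotient map. The inclusions of \<open>X\<close> and \<open>Y\<close> into \<open>X \<union> Y\<close> are identities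
  here, so \<open>iota_X\<close> and \<open>iota_Y\<close> share their formula and differ only in their intended domains.\<close>

definition iota_X :: "'a rel \<Rightarrow> 'a \<Rightarrow> 'a set" where
  "iota_X r x = Equiv_Relations.proj (r \<inter> r\<inverse>) x"

definition iota_Y :: "'a rel \<Rightarrow> 'a \<Rightarrow> 'a set" where
  "iota_Y r y = Equiv_Relations.proj (r \<inter> r\<inverse>) y"

lemma partial_order_on_uplus:
  assumes "preorder_on (setX E \<union> setY E) r"
  shows "partial_order_on (uplus_set E r) (uplus_le E r)"
proof -
  let ?U = "uplus_set E r" and ?q = "r \<inter> r\<inverse>"
  have tr: "trans r" and rf: "refl_on (setX E \<union> setY E) r" and sub: "r \<subseteq> (setX E \<union> setY E) \<times> (setX E \<union> setY E)"
    using assms by (simp_all add: preorder_on_def)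
  have eq: "equiv (setX E \<union> setY E) ?q"
    using sub rf tr by (auto simp: equiv_def refl_on_def sym_def trans_Int)
  have inr: "(a, a') \<in> r" if "A \<in> ?U" "a \<in> A" "a' \<in> A" for A a a'
    using quotient_eq_iff[OF eq, of A A a a'] that by (simp add: uplus_set_def)
  have le: "(A, B) \<in> uplus_le E r \<longleftrightarrow> A \<in> ?U \<and> B \<in> ?U \<and> (\<exists>a\<in>A. \<exists>b\<in>B. (a, b) \<in> r)" for A B
    by (simp add: uplus_le_def)
  have ne: "\<exists>a. a \<in> A" if "A \<in> ?U" for A
    using in_quotient_imp_non_empty[OF eq] that by (auto simp: uplus_set_def)
  have "refl_on ?U (uplus_le E r)"
    unfolding refl_on_def le using ne inr by blast
  moreover have "trans (uplus_le E r)"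
  proof (rule transI)
    fix A B C assume "(A, B) \<in> uplus_le E r" "(B, C) \<in> uplus_le E r"
    then obtain a b b' c where *: "A \<in> ?U" "B \<in> ?U" "C \<in> ?U" "a \<in> A" "b \<in> B" "b' \<in> B" "c \<in> C"
      "(a, b) \<in> r" "(b', c) \<in> r" by (auto simp: le)
    have "(a, c) \<in> r" by (rule transD[OF tr transD[OF tr *(8) inr[OF *(2,5,6)]] *(9)])
    with * show "(A, C) \<in> uplus_le E r" by (auto simp: le)
  qed
  moreover have "antisym (uplus_le E r)"
  proof (rule antisymI)
    fix A B assume "(A, B) \<in> uplus_le E r" "(B, A) \<in> uplus_le E r"
    then obtain a a' b b' where *: "A \<in> ?U" "B \<in> ?U" "a \<in> A" "a' \<in> A" "b \<in> B" "b' \<in> B"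
      "(a, b) \<in> r" "(b', a') \<in> r" by (auto simp: le)
    have "(b, a) \<in> r"
      by (rule transD[OF tr transD[OF tr inr[OF *(2,5,6)] *(8)] inr[OF *(1,4,3)]])
    with * show "A = B"
      using quotient_eq_iff[OF eq, of A B a b] by (simp add: uplus_set_def)
  qed
  moreover have "uplus_le E r \<subseteq> ?U \<times> ?U" by (auto simp: le)
  ultimately show ?thesis by (simp add: partial_order_on_def preorder_on_def)
qed

lemma iota_in_uplus_set:
  "x \<in> setX E \<Longrightarrow> iota_X r x \<in> uplus_set E r"
  "y \<in> setY E \<Longrightarrow> iota_Y r y \<in> uplus_set E r"
  by (auto simp: iota_X_def iota_Y_def uplus_set_def Equiv_Relations.proj_def intro: quotientI)

definition zero_preorder :: "('p, 'a) polarity \<Rightarrow> 'a rel \<Rightarrow> bool" where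
  "zero_preorder E r \<longleftrightarrow>
     preorder_on (setX E \<union> setY E) r \<and>
     (\<forall>x\<in>setX E. \<forall>y\<in>setY E. (x, y) \<in> r \<longleftrightarrow> (x, y) \<in> relR E) \<and>
     (\<forall>x1\<in>setX E. \<forall>x2\<in>setX E. (x1, x2) \<in> leX E \<longrightarrow> (x1, x2) \<in> r) \<and>
     (\<forall>y1\<in>setY E. \<forall>y2\<in>setY E. (y1, y2) \<in> leY E \<longrightarrow> (y1, y2) \<in> r)"

definition one_preorder :: "('p, 'a) polarity \<Rightarrow> 'a rel \<Rightarrow> bool" where
  "one_preorder E r \<longleftrightarrow>
     zero_preorder E r \<and> (\<forall>p\<in>setP E. (iota_X r \<circ> eX E) p = (iota_Y r \<circ> eY E) p)"

definition Z_X :: "('p, 'a) polarity \<Rightarrow> 'a rel" where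
  "Z_X E = {(x1, x2). x1 \<in> setX E \<and> x2 \<in> setX E \<and>
     (\<exists>p\<in>setP E. (x1, eY E p) \<in> relR E \<and> (eX E p, x2) \<in> leX E)} \<union> leX E"

definition Z_Y :: "('p, 'a) polarity \<Rightarrow> 'a rel" where
  "Z_Y E = {(y1, y2). y1 \<in> setY E \<and> y2 \<in> setY E \<and>
     (\<exists>p\<in>setP E. (y1, eY E p) \<in> leY E \<and> (eX E p, y2) \<in> relR E)} \<union> leY E"

definition Z_YX :: "('p, 'a) polarity \<Rightarrow> 'a rel" where
  "Z_YX E = {(y, x). y \<in> setY E \<and> x \<in> setX E \<and>
     (\<exists>p\<in>setP E. \<exists>q\<in>setP E.
        (y, eY E p) \<in> leY E \<and> (eX E p, eY E q) \<in> relR E \<and> (eX E q, x) \<in> leX E)}"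

definition preceq1 :: "('p, 'a) polarity \<Rightarrow> 'a rel" where
  "preceq1 E = relR E \<union> Z_X E \<union> Z_Y E \<union> Z_YX E"

end

theory Submission
  imports Defs
begin

text \<open>Equality of \<open>\<iota>\<^sub>X \<circ> e\<^sub>X\<close> and \<open>\<iota>\<^sub>Y \<circ> e\<^sub>Y\<close> means that \<open>e\<^sub>X p\<close> and \<open>e\<^sub>Y p\<close> lie below
  each other for every \<open>p\<close>. Hence every pair in \<open>\<preceq>\<^sub>1\<close> is a chain of steps that any 1-preorder
  contains, which makes \<open>\<preceq>\<^sub>1\<close> least, and (C1)--(C4) are instances of transitivity of a
  1-preorder. Conversely, in a composite of two \<open>\<preceq>\<^sub>1\<close>-steps, (C1), (C2) and (C4) contract
  consecutive \<open>R\<close>-steps linked by \<open>\<le>\<^sub>X\<close>, \<open>\<le>\<^sub>Y\<close> or an element of \<open>P\<close> into a single one, so that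
  \<open>\<preceq>\<^sub>1\<close> is transitive.\<close>

lemma proj_eq_iff_mutual:
  assumes "preorder_on A r" and "x \<in> A" and "y \<in> A"
  shows "Equiv_Relations.proj (r \<inter> r\<inverse>) x = Equiv_Relations.proj (r \<inter> r\<inverse>) y \<longleftrightarrow>
    (x, y) \<in> r \<and> (y, x) \<in> r"
proof -
  have "equiv A (r \<inter> r\<inverse>)"
    using assms(1) by (auto simp: preorder_on_def equiv_def refl_on_def sym_def trans_Int)
  from eq_equiv_class_iff[OF this assms(2,3)] show ?thesis
    by (auto simp: Equiv_Relations.proj_def)
qed

lemma extension_polarityD:
  assumes "extension_polarity E"
  shows "refl_on (setX E) (leX E)" "trans (leX E)" "leX E \<subseteq> setX E \<times> setX E"
    "refl_on (setY E) (leY E)" "trans (leY E)" "leY E \<subseteq> setY E \<times> setY E"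
    "setX E \<inter> setY E = {}" "relR E \<subseteq> setX E \<times> setY E"
    "p \<in> setP E \<Longrightarrow> eX E p \<in> setX E" "p \<in> setP E \<Longrightarrow> eY E p \<in> setY E"
  using assms unfolding extension_polarity_def partial_order_on_def preorder_on_def
    order_embedding_on_def by auto

text \<open>Trades equality of classes in the quotient for two memberships in \<open>r\<close>, so
  that later proofs avoid equivalence classes.\<close>

lemma one_preorder_iff:
  assumes "extension_polarity E"
  shows "one_preorder E r \<longleftrightarrow>
    zero_preorder E r \<and> (\<forall>p\<in>setP E. (eX E p, eY E p) \<in> r \<and> (eY E p, eX E p) \<in> r)"
proof -
  have "iota_X r (eX E p) = iota_Y r (eY E p) \<longleftrightarrow> (eX E p, eY E p) \<in> r \<and> (eY E p, eX E p) \<in> r"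
    if "preorder_on (setX E \<union> setY E) r" "p \<in> setP E" for p
    unfolding iota_X_def iota_Y_def
    by (rule proj_eq_iff_mutual[OF that(1)])
      (use extension_polarityD(9,10)[OF assms] that(2) in auto)
  then show ?thesis
    by (auto simp: one_preorder_def zero_preorder_def)
qed

lemma one_preorderD:
  assumes "extension_polarity E" and "one_preorder E r"
  shows "preorder_on (setX E \<union> setY E) r" "trans r"
    "x \<in> setX E \<Longrightarrow> y \<in> setY E \<Longrightarrow> (x, y) \<in> r \<longleftrightarrow> (x, y) \<in> relR E"
    "relR E \<subseteq> r" "leX E \<subseteq> r" "leY E \<subseteq> r"
    "p \<in> setP E \<Longrightarrow> (eX E p, eY E p) \<in> r" "p \<in> setP E \<Longrightarrow> (eY E p, eX E p) \<in> r"
  using assms(2) extension_polarityD(3,6,8)[OF assms(1)]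
  unfolding one_preorder_iff[OF assms(1)] zero_preorder_def preorder_on_def by blast+

lemma one_preorder_imp_one_coherent:
  assumes E: "extension_polarity E" and r: "one_preorder E r"
  shows "one_coherent E"
proof -
  note D = extension_polarityD(9,10)[OF E] one_preorderD(3-8)[OF E r]
  note tr = transD[OF one_preorderD(2)[OF E r]]
  have "C1 E" unfolding C1_def using D(3-5) tr by blast
  moreover have "C2 E" unfolding C2_def using D(3,4,6) tr by blast
  moreover have "C3 E" unfolding C3_def using D(1-3,7) by blast
  \<comment> \<open>The chain is \<open>x\<close>, \<open>eY E p\<close>, \<open>eX E p\<close>,
    \<open>y\<close>; its middle link is the half of the identification that lies outside
    \<open>relR E\<close>.\<close>
  moreover have "C4 E" unfolding C4_def using D(3,4,8) tr by blast
  ultimately show ?thesis by (simp add: one_coherent_def)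
qed

lemma preceq1_subset_one_preorder:
  assumes E: "extension_polarity E" and r: "one_preorder E r"
  shows "preceq1 E \<subseteq> r"
proof -
  note D = one_preorderD(4-6,8)[OF E r]
  note tr = transD[OF one_preorderD(2)[OF E r]]
  have "Z_X E \<subseteq> r" unfolding Z_X_def using D(1,2,4) tr by blast
  moreover have "Z_Y E \<subseteq> r" unfolding Z_Y_def using D(1,3,4) tr by blast
  moreover have "Z_YX E \<subseteq> r"
  proof
    fix z assume "z \<in> Z_YX E"
    then obtain y x p q where z: "z = (y, x)" and pq: "p \<in> setP E" "q \<in> setP E"
      and "(y, eY E p) \<in> r" "(eX E p, eY E q) \<in> r" "(eX E q, x) \<in> r"
      unfolding Z_YX_def using D(1-3) by blast
    \<comment> \<open>The chain is \<open>y\<close>, \<open>eY E p\<close>, \<open>eX E p\<close>,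
      \<open>eY E q\<close>, \<open>eX E q\<close>, \<open>x\<close>; \<open>D(4)\<close> supplies
      its second and fourth links.\<close>
    with D(4)[OF pq(1)] D(4)[OF pq(2)] tr show "z \<in> r" by metis
  qed
  ultimately show ?thesis using D(1) by (simp add: preceq1_def)
qed

text \<open>As the carriers are disjoint, the four pieces of \<open>preceq1 E\<close> lie in four
  disjoint blocks and cannot interfere. In the block from \<open>X\<close> to \<open>Y\<close> this
  is already the defining equivalence of a 0-preorder.\<close>

lemma preceq1_cases:
  assumes "extension_polarity E"
  shows "x \<in> setX E \<Longrightarrow> y \<in> setY E \<Longrightarrow> (x, y) \<in> preceq1 E \<longleftrightarrow> (x, y) \<in> relR E"
    "x \<in> setX E \<Longrightarrow> x' \<in> setX E \<Longrightarrow> (x, x') \<in> preceq1 E \<longleftrightarrow> (x, x') \<in> Z_X E"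
    "y \<in> setY E \<Longrightarrow> y' \<in> setY E \<Longrightarrow> (y, y') \<in> preceq1 E \<longleftrightarrow> (y, y') \<in> Z_Y E"
    "y \<in> setY E \<Longrightarrow> x \<in> setX E \<Longrightarrow> (y, x) \<in> preceq1 E \<longleftrightarrow> (y, x) \<in> Z_YX E"
    "preceq1 E \<subseteq> (setX E \<union> setY E) \<times> (setX E \<union> setY E)"
  using extension_polarityD(3,6-8)[OF assms]
  unfolding preceq1_def Z_X_def Z_Y_def Z_YX_def by blast+

text \<open>There is one case per choice of carriers for \<open>a\<close>, \<open>b\<close>,
  \<open>c\<close>. Where the composite needs witnesses from \<open>P\<close>, a start in
  \<open>Y\<close> keeps the first one on the chain and an end in \<open>X\<close> keeps the last;
  (C4) absorbs the others.\<close>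

lemma trans_preceq1:
  assumes E: "extension_polarity E" and coh: "one_coherent E"
  shows "trans (preceq1 E)"
proof (rule transI)
  note D = extension_polarityD[OF E]
  note trX = transD[OF D(2)] and trY = transD[OF D(5)]
  have C1: "(x1, y) \<in> relR E" if "(x1, x2) \<in> leX E" "(x2, y) \<in> relR E" for x1 x2 y
    using that coh D(3,8) unfolding one_coherent_def C1_def by blast
  have C2: "(x, y2) \<in> relR E" if "(x, y1) \<in> relR E" "(y1, y2) \<in> leY E" for x y1 y2
    using that coh D(6,8) unfolding one_coherent_def C2_def by blast
  have C4: "(x, y) \<in> relR E" if "p \<in> setP E" "(x, eY E p) \<in> relR E" "(eX E p, y) \<in> relR E" for p x y
    using that coh D(8) unfolding one_coherent_def C4_def by blast
  note pre = preceq1_cases[OF E]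
  fix a b c assume ab: "(a, b) \<in> preceq1 E" and bc: "(b, c) \<in> preceq1 E"
  then have "a \<in> setX E \<union> setY E" "b \<in> setX E \<union> setY E" "c \<in> setX E \<union> setY E"
    using pre(5) by auto
  then consider
      (XXX) "a \<in> setX E" "b \<in> setX E" "c \<in> setX E" | (XXY) "a \<in> setX E" "b \<in> setX E" "c \<in> setY E"
    | (XYX) "a \<in> setX E" "b \<in> setY E" "c \<in> setX E" | (XYY) "a \<in> setX E" "b \<in> setY E" "c \<in> setY E"
    | (YXX) "a \<in> setY E" "b \<in> setX E" "c \<in> setX E" | (YXY) "a \<in> setY E" "b \<in> setX E" "c \<in> setY E"
    | (YYX) "a \<in> setY E" "b \<in> setY E" "c \<in> setX E" | (YYY) "a \<in> setY E" "b \<in> setY E" "c \<in> setY E"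
    by blast
  then show "(a, c) \<in> preceq1 E"
  proof cases
    case XXX
    with ab bc have "(a, b) \<in> Z_X E" "(b, c) \<in> Z_X E" by (simp_all add: pre)
    \<comment> \<open>If the steps pass through \<open>p\<close> and then \<open>q\<close>,
      \<open>C1\<close> gives \<open>eX E p\<close> \<open>R\<close> \<open>eY E q\<close>,
      \<open>C4\<close> at \<open>p\<close> gives \<open>a\<close> \<open>R\<close>
      \<open>eY E q\<close>, and \<open>q\<close> is the witness.\<close>
    then have "(a, c) \<in> Z_X E"
      unfolding Z_X_def using XXX by (blast intro: trX C1 C4)
    with XXX show ?thesis by (simp add: pre)
  next
    case XXY
    with ab bc have "(a, b) \<in> Z_X E" "(b, c) \<in> relR E" by (simp_all add: pre)
    then have "(a, c) \<in> relR E"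
      unfolding Z_X_def by (blast intro: C1 C4)
    with XXY show ?thesis by (simp add: pre)
  next
    case XYX
    with ab bc have "(a, b) \<in> relR E" "(b, c) \<in> Z_YX E" by (simp_all add: pre)
    then have "(a, c) \<in> Z_X E"
      unfolding Z_X_def Z_YX_def using XYX by (blast intro: C2 C4)
    with XYX show ?thesis by (simp add: pre)
  next
    case XYY
    with ab bc have "(a, b) \<in> relR E" "(b, c) \<in> Z_Y E" by (simp_all add: pre)
    then have "(a, c) \<in> relR E"
      unfolding Z_Y_def by (blast intro: C2 C4)
    with XYY show ?thesis by (simp add: pre)
  next
    case YXX
    with ab bc have "(a, b) \<in> Z_YX E" "(b, c) \<in> Z_X E" by (simp_all add: pre)
    then have "(a, c) \<in> Z_YX E"
      unfolding Z_X_def Z_YX_def using YXX by (blast intro: trX C1 C4)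
    with YXX show ?thesis by (simp add: pre)
  next
    case YXY
    with ab bc have "(a, b) \<in> Z_YX E" "(b, c) \<in> relR E" by (simp_all add: pre)
    \<comment> \<open>With \<open>p\<close>, \<open>q\<close> from \<open>Z_YX E\<close>,
      \<open>C1\<close> gives \<open>eX E q\<close> \<open>R\<close> \<open>c\<close> and
      \<open>C4\<close> at \<open>q\<close> gives \<open>eX E p\<close> \<open>R\<close>
      \<open>c\<close>. This composite explains why \<open>Z_Y E\<close> has to extend
      \<open>leY E\<close>.\<close>
    then have "(a, c) \<in> Z_Y E"
      unfolding Z_Y_def Z_YX_def using YXY by (blast intro: C1 C4)
    with YXY show ?thesis by (simp add: pre)
  next
    case YYX
    with ab bc have "(a, b) \<in> Z_Y E" "(b, c) \<in> Z_YX E" by (simp_all add: pre)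
    then have "(a, c) \<in> Z_YX E"
      unfolding Z_Y_def Z_YX_def using YYX by (blast intro: trY C2 C4)
    with YYX show ?thesis by (simp add: pre)
  next
    case YYY
    with ab bc have "(a, b) \<in> Z_Y E" "(b, c) \<in> Z_Y E" by (simp_all add: pre)
    then have "(a, c) \<in> Z_Y E"
      unfolding Z_Y_def using YYY by (blast intro: trY C2 C4)
    with YYY show ?thesis by (simp add: pre)
  qed
qed

lemma one_coherent_imp_one_preorder_preceq1:
  assumes E: "extension_polarity E" and coh: "one_coherent E"
  shows "one_preorder E (preceq1 E)"
proof -
  note D = extension_polarityD[OF E]
  have C3: "(eX E p, eY E p) \<in> relR E" if "p \<in> setP E" for p
    using coh that by (simp add: one_coherent_def C3_def)
  have le: "leX E \<subseteq> preceq1 E" "leY E \<subseteq> preceq1 E"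
    by (auto simp: preceq1_def Z_X_def Z_Y_def)
  have "refl_on (setX E \<union> setY E) (preceq1 E)"
    using D(1,4) le unfolding refl_on_def by blast
  then have "preorder_on (setX E \<union> setY E) (preceq1 E)"
    using preceq1_cases(5)[OF E] trans_preceq1[OF E coh] by (simp add: preorder_on_def)
  then have "zero_preorder E (preceq1 E)"
    using preceq1_cases(1)[OF E] le unfolding zero_preorder_def by blast
  moreover have "(eY E p, eX E p) \<in> preceq1 E" if p: "p \<in> setP E" for p
  proof -
    \<comment> \<open>Both witnesses are \<open>p\<close>: the outer links are reflexivity and the
      middle one is (C3).\<close>
    have "(eY E p, eX E p) \<in> Z_YX E"
      unfolding Z_YX_def using p D(9,10)[OF p] refl_onD[OF D(1)] refl_onD[OF D(4)] C3[OF p] by blast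
    then show ?thesis by (simp add: preceq1_def)
  qed
  ultimately show ?thesis
    using C3 by (auto simp: one_preorder_iff[OF E] preceq1_def)
qed

lemma one_preorder_Inter:
  assumes E: "extension_polarity E" and "S \<noteq> {}" and S: "\<And>r. r \<in> S \<Longrightarrow> one_preorder E r"
  shows "one_preorder E (\<Inter>S)"
proof -
  note D = one_preorderD[OF E S]
  from \<open>S \<noteq> {}\<close> obtain s where s: "s \<in> S" by blast
  have "refl_on (setX E \<union> setY E) (\<Inter>S)"
    using D(1) unfolding preorder_on_def refl_on_def by blast
  moreover have "trans (\<Inter>S)"
    using D(2) unfolding trans_def by blast
  \<comment> \<open>A member \<open>s\<close> is required here, since the empty intersection is the
    universal relation; the same member bounds the pairs from \<open>X\<close> to \<open>Y\<close>
    by \<open>relR E\<close>.\<close>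
  moreover have "\<Inter>S \<subseteq> (setX E \<union> setY E) \<times> (setX E \<union> setY E)"
    using D(1)[OF s] s unfolding preorder_on_def by blast
  ultimately have "preorder_on (setX E \<union> setY E) (\<Inter>S)"
    by (simp add: preorder_on_def)
  moreover have "(x, y) \<in> \<Inter>S \<longleftrightarrow> (x, y) \<in> relR E" if "x \<in> setX E" "y \<in> setY E" for x y
    using D(3)[OF _ that] s by blast
  ultimately have "zero_preorder E (\<Inter>S)"
    using D(5,6) unfolding zero_preorder_def by blast
  then show ?thesis
    using D(7,8) by (auto simp: one_preorder_iff[OF E])
qed

theorem theorem3p11:
  fixes E :: "('p, 'a) polarity"
  assumes "extension_polarity E"
  shows "(one_coherent E \<longleftrightarrow> one_preorder E (preceq1 E)) \<and>
    (one_preorder E (preceq1 E) \<longleftrightarrow> (\<exists>r. one_preorder E r)) \<and>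
    (\<forall>S. S \<noteq> {} \<and> S \<subseteq> {r. one_preorder E r} \<longrightarrow> \<Inter>S \<in> {r. one_preorder E r}) \<and>
    ({r. one_preorder E r} \<noteq> {} \<longrightarrow>
       preceq1 E \<in> {r. one_preorder E r} \<and> (\<forall>r\<in>{r. one_preorder E r}. preceq1 E \<subseteq> r))"
proof -
  note to_coherent = one_preorder_imp_one_coherent[OF assms]
  note to_preceq1 = one_coherent_imp_one_preorder_preceq1[OF assms]
  have "\<Inter>S \<in> {r. one_preorder E r}" if "S \<noteq> {}" "S \<subseteq> {r. one_preorder E r}" for S
    using one_preorder_Inter[OF assms that(1)] that(2) by blast
  \<comment> \<open>The equivalences close as a cycle: (1) yields (2), (2) is an instance of (3),
    and any 1-preorder yields (1).\<close>
  then show ?thesis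
    using to_coherent to_preceq1 preceq1_subset_one_preorder[OF assms] by blast
qed

end
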